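(* Let $d\ge1$ and $0<\lambda<1$. Then there exists a Borel probability measure $\mu^*$ on $\mathbb S^d$ such that $I_\lambda(\mu^* )>I_\lambda(\mu_{ONB})$.
   Context: For $x,y\in\mathbb S^d\subset\mathbb R^{d+1}$, $\theta(x,y)=\arccos|x\cdot y|$, and $I_\lambda(\mu)=\int_{\mathbb S^d}\int_{\mathbb S^d}\theta(x,y)^\lambda\,d\mu(x)\,d\mu(y)$ for a Borel probability measure $\mu$ on $\mathbb S^d$. $\mu_{ONB}=\frac1{d+1}\sum_{i=1}^{d+1}\delta_{e_i}$, where $\{e_1,\dots,e_{d+1}\}$ is an orthonormal basis of $\mathbb R^{d+1}$. *)

theory Defs
  imports "HOL-Analysis.Analysis" "HOL-Probability.Probability"
begin

text \<open>
  The sphere \<open>S\<^sup>d\<close> is the unit sphere of \<open>real ^ 'n\<close> with \<open>CARD('n) = d + 1\<close>, equipped with the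
  Borel sigma-algebra of its subspace topology.
\<close>

abbreviation unit_sphere :: "(real ^ 'n) set" where
  "unit_sphere \<equiv> sphere 0 1"

abbreviation sphere_borel :: "(real ^ 'n) measure" where
  "sphere_borel \<equiv> restrict_space borel unit_sphere"

definition borel_prob_on_sphere :: "(real ^ 'n) measure \<Rightarrow> bool" where
  "borel_prob_on_sphere \<mu> \<longleftrightarrow> prob_space \<mu> \<and> sets \<mu> = sets sphere_borel"

definition theta :: "real ^ 'n \<Rightarrow> real ^ 'n \<Rightarrow> real" where
  "theta x y = arccos \<bar>x \<bullet> y\<bar>"

text \<open>Since \<open>0 powr lam = 0\<close>, this agrees with \<open>theta^lam\<close> also on the diagonal, provided \<open>lam > 0\<close>.\<close>

definition energy :: "real \<Rightarrow> (real ^ 'n) measure \<Rightarrow> real" where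
  "energy lam \<mu> = (LINT y|\<mu>. LINT x|\<mu>. theta x y powr lam)"

definition orthonormal_basis :: "('n \<Rightarrow> real ^ 'n) \<Rightarrow> bool" where
  "orthonormal_basis e \<longleftrightarrow>
     (\<forall>i j. e i \<bullet> e j = (if i = j then 1 else 0)) \<and> span (range e) = UNIV"

text \<open>
  The average of the Dirac measures at the points \<open>e i\<close>. As \<open>measure_of\<close> yields the zero measure
  unless its last argument is countably additive, this is established in \<open>emeasure_mu_ONB\<close>.
\<close>

definition mu_ONB :: "('n \<Rightarrow> real ^ 'n) \<Rightarrow> (real ^ 'n) measure" where
  "mu_ONB e = measure_of unit_sphere (sets sphere_borel)
     (\<lambda>A. ennreal (1 / real CARD('n)) * (\<Sum>i\<in>UNIV. emeasure (return sphere_borel (e i)) A))"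

lemma space_sphere_borel: "space sphere_borel = unit_sphere"
  by (simp add: space_restrict_space)

lemma sets_mu_ONB: "sets (mu_ONB e) = sets sphere_borel"
  unfolding mu_ONB_def
  by (metis sets.sets_measure_of_eq space_sphere_borel)

lemma emeasure_mu_ONB:
  fixes e :: "'n::finite \<Rightarrow> real ^ 'n"
  assumes A: "A \<in> sets sphere_borel"
  shows "emeasure (mu_ONB e) A =
    ennreal (1 / real CARD('n)) * (\<Sum>i\<in>UNIV. emeasure (return sphere_borel (e i)) A)"
proof (rule emeasure_measure_of[OF mu_ONB_def])
  show "sets sphere_borel \<subseteq> Pow (unit_sphere :: (real ^ 'n) set)"
    using sets.space_closed[of sphere_borel] by (simp only: space_sphere_borel)
  show "A \<in> sets (mu_ONB e)" using A by (simp only: sets_mu_ONB)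
  let ?f = "\<lambda>A. ennreal (1 / real CARD('n)) * (\<Sum>i\<in>UNIV. emeasure (return sphere_borel (e i)) A)"
  show "positive (sets (mu_ONB e)) ?f" by (simp add: positive_def)
  show "countably_additive (sets (mu_ONB e)) ?f"
  proof (rule countably_additiveI)
    fix F :: "nat \<Rightarrow> (real ^ 'n) set"
    assume F: "range F \<subseteq> sets (mu_ONB e)" "disjoint_family F"
    then have F': "range F \<subseteq> sets (return sphere_borel (e i))" for i
      by (simp only: sets_mu_ONB sets_return)
    show "(\<Sum>k. ?f (F k)) = ?f (\<Union>k. F k)"
      by (simp add: suminf_emeasure[OF F' F(2), symmetric] suminf_sum)
  qed
qed

lemma borel_prob_on_sphere_mu_ONB:
  fixes e :: "'n::finite \<Rightarrow> real ^ 'n"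
  assumes "orthonormal_basis e"
  shows "borel_prob_on_sphere (mu_ONB e)"
proof -
  have e: "e i \<in> unit_sphere" for i
    using assms by (simp add: orthonormal_basis_def norm_eq_sqrt_inner)
  have sp: "space (mu_ONB e) = unit_sphere"
    using sets_eq_imp_space_eq[OF sets_mu_ONB] by (simp only: space_sphere_borel)
  have top: "unit_sphere \<in> sets (sphere_borel :: (real ^ 'n) measure)"
    by (metis sets.top space_sphere_borel)
  have "emeasure (mu_ONB e) unit_sphere = ennreal (1 / real CARD('n)) * of_nat CARD('n)"
    unfolding emeasure_mu_ONB[OF top] using e top by simp
  also have "\<dots> = 1"
    by (simp add: ennreal_of_nat_eq_real_of_nat flip: ennreal_mult')
  finally have "prob_space (mu_ONB e)"
    by (intro prob_spaceI) (simp only: sp)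
  then show ?thesis
    by (simp add: borel_prob_on_sphere_def sets_mu_ONB)
qed

end

theory Submission
  imports Defs
begin

text \<open>
  Any two vectors \<open>e a\<close>, \<open>e b\<close> of the orthonormal basis can be rotated by \<open>\<pi>/4\<close> in their plane,
  which gives a second orthonormal basis \<open>f\<close>, and \<open>\<mu>*\<close> is the average of \<open>mu_ONB e\<close> and \<open>mu_ONB f\<close>.
  The energy is a quadratic form in the measure and both bases have the same energy, so it suffices
  that the mutual energy of \<open>e\<close> and \<open>f\<close> exceeds the energy of \<open>e\<close>. The two differ only in the plane
  of \<open>e a\<close> and \<open>e b\<close>: there each row of the angle matrix has entries \<open>0, \<pi>/2\<close> for the pair
  \<open>(e, e)\<close> and \<open>\<pi>/4, \<pi>/4\<close> for the pair \<open>(e, f)\<close>, and strict concavity of \<open>t \<mapsto> t^\<lambda>\<close> for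
  \<open>0 < \<lambda> < 1\<close> gives \<open>2 (\<pi>/4)^\<lambda> > (\<pi>/2)^\<lambda>\<close> (lemma \<open>twice_quarter_powr\<close>).

  Both measures are images of the uniform distribution on a finite index type, for which the energy
  is a finite double sum (lemma \<open>energy_uniform_points\<close>).
\<close>

definition uniform_points :: "('k::finite \<Rightarrow> real ^ 'n) \<Rightarrow> (real ^ 'n) measure" where
  "uniform_points p = distr (measure_pmf (pmf_of_set UNIV)) sphere_borel p"

definition mutual_energy_sum ::
    "real \<Rightarrow> ('k::finite \<Rightarrow> real ^ 'n) \<Rightarrow> ('l::finite \<Rightarrow> real ^ 'n) \<Rightarrow> real" where
  "mutual_energy_sum lam p q = (\<Sum>i\<in>UNIV. \<Sum>j\<in>UNIV. theta (p i) (q j) powr lam)"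

lemma theta_commute: "theta x y = theta y x"
  by (simp add: theta_def inner_commute)

lemma mutual_energy_sum_commute: "mutual_energy_sum lam p q = mutual_energy_sum lam q p"
  unfolding mutual_energy_sum_def by (subst sum.swap) (simp add: theta_commute)

text \<open>
  As \<open>arccos\<close> inverts the cosine, and is therefore continuous, only on \<open>[-1, 1]\<close>, the Cauchy-Schwarz inequality on the sphere is what
  makes the integrand measurable.
\<close>

lemma borel_measurable_theta_powr:
  fixes y :: "real ^ 'n::finite"
  assumes "norm y = 1"
  shows "(\<lambda>x. theta x y powr lam) \<in> borel_measurable sphere_borel"
proof -
  have "\<bar>x \<bullet> y\<bar> \<le> 1" if "x \<in> unit_sphere" for x
    using Cauchy_Schwarz_ineq2[of x y] that assms by simp
  then have "continuous_on unit_sphere (\<lambda>x. theta x y)"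
    unfolding theta_def by (intro continuous_intros) (auto intro: order_trans[of _ 0])
  then have "(\<lambda>x. theta x y) \<in> borel_measurable sphere_borel"
    by (rule borel_measurable_continuous_on_restrict)
  then show ?thesis by measurable
qed

lemma measurable_points:
  fixes p :: "'k::finite \<Rightarrow> real ^ 'n::finite"
  assumes "\<And>i. norm (p i) = 1"
  shows "p \<in> measurable (measure_pmf M) sphere_borel"
  using assms by (simp add: space_restrict_space)

lemma borel_prob_on_sphere_uniform_points:
  fixes p :: "'k::finite \<Rightarrow> real ^ 'n::finite"
  assumes "\<And>i. norm (p i) = 1"
  shows "borel_prob_on_sphere (uniform_points p)"
  unfolding borel_prob_on_sphere_def uniform_points_def
  using measure_pmf.prob_space_distr[OF measurable_points[OF assms]] by simp

lemma integral_uniform_points: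
  fixes p :: "'k::finite \<Rightarrow> real ^ 'n::finite" and g :: "real ^ 'n \<Rightarrow> real"
  assumes "\<And>i. norm (p i) = 1" and "g \<in> borel_measurable sphere_borel"
  shows "(LINT x|uniform_points p. g x) = (\<Sum>i\<in>UNIV. g (p i)) / CARD('k)"
  unfolding uniform_points_def
  by (simp add: integral_distr[OF measurable_points[OF assms(1)] assms(2)] integral_pmf_of_set)

lemma energy_uniform_points:
  fixes p :: "'k::finite \<Rightarrow> real ^ 'n::finite"
  assumes p: "\<And>i. norm (p i) = 1"
  shows "energy lam (uniform_points p) = mutual_energy_sum lam p p / (real CARD('k))\<^sup>2"
proof -
  have space: "space (uniform_points p) = unit_sphere"
    by (simp add: uniform_points_def space_restrict_space)
  have "energy lam (uniform_points p) =
      (LINT y|uniform_points p. (\<Sum>i\<in>UNIV. theta (p i) y powr lam) / CARD('k))"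
    unfolding energy_def
  proof (rule Bochner_Integration.integral_cong[OF refl])
    fix y assume "y \<in> space (uniform_points p)"
    then have "norm y = 1" by (simp add: space)
    then show "(LINT x|uniform_points p. theta x y powr lam) =
        (\<Sum>i\<in>UNIV. theta (p i) y powr lam) / CARD('k)"
      by (intro integral_uniform_points p borel_measurable_theta_powr)
  qed
  also have "\<dots> = (\<Sum>j\<in>UNIV. (\<Sum>i\<in>UNIV. theta (p i) (p j) powr lam) / CARD('k)) / CARD('k)"
  proof (rule integral_uniform_points[OF p])
    have "(\<lambda>y. theta (p i) y powr lam) \<in> borel_measurable sphere_borel" for i
      using borel_measurable_theta_powr[OF p] by (subst theta_commute)
    then show "(\<lambda>y. (\<Sum>i\<in>UNIV. theta (p i) y powr lam) / CARD('k)) \<in> borel_measurable sphere_borel"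
      by measurable
  qed
  also have "\<dots> = mutual_energy_sum lam p p / (real CARD('k))\<^sup>2"
    unfolding mutual_energy_sum_def
    by (subst sum.swap) (simp add: power2_eq_square flip: sum_divide_distrib)
  finally show ?thesis .
qed

lemma mu_ONB_eq_uniform_points:
  fixes e :: "'n::finite \<Rightarrow> real ^ 'n"
  assumes e: "\<And>i. norm (e i) = 1"
  shows "mu_ONB e = uniform_points e"
proof (rule measure_eqI)
  show "sets (mu_ONB e) = sets (uniform_points e)"
    by (simp only: sets_mu_ONB uniform_points_def sets_distr)
next
  fix A assume "A \<in> sets (mu_ONB e)"
  then have A: "A \<in> sets sphere_borel" by (simp only: sets_mu_ONB)
  have "emeasure (uniform_points e) A = card {i. e i \<in> A} / CARD('n)"
    unfolding uniform_points_def
    by (simp add: emeasure_distr[OF measurable_points[OF e] A] emeasure_pmf_of_set vimage_def)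
  also have "\<dots> = ennreal (1 / CARD('n)) * (\<Sum>i\<in>UNIV. indicator A (e i))"
    by (simp add: indicator_def sum.If_cases ennreal_of_nat_eq_real_of_nat flip: ennreal_mult')
  also have "\<dots> = emeasure (mu_ONB e) A"
    unfolding emeasure_mu_ONB[OF A] using A by simp
  finally show "emeasure (mu_ONB e) A = emeasure (uniform_points e) A" by simp
qed

text \<open>
  The uniform measure on a family indexed by \<open>'k \<times> bool\<close> is the average of the uniform measures on
  its two halves, so this is the expansion of the energy as a quadratic form.
\<close>

lemma mutual_energy_sum_superposition:
  fixes p q :: "'k::finite \<Rightarrow> real ^ 'n"
  defines "r \<equiv> \<lambda>(i, s). if s then p i else q i"
  shows "mutual_energy_sum lam r r =
    mutual_energy_sum lam p p + 2 * mutual_energy_sum lam p q + mutual_energy_sum lam q q"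
proof -
  have sum_pairs: "(\<Sum>x\<in>UNIV. g x) = (\<Sum>i\<in>UNIV. g (i, True)) + (\<Sum>i\<in>UNIV. g (i, False))"
    for g :: "'k \<times> bool \<Rightarrow> real"
    using sum.cartesian_product'[of g UNIV UNIV] unfolding UNIV_Times_UNIV
    by (simp add: UNIV_bool sum.distrib)
  have "mutual_energy_sum lam r r = mutual_energy_sum lam p p + mutual_energy_sum lam p q
      + mutual_energy_sum lam q p + mutual_energy_sum lam q q"
    unfolding mutual_energy_sum_def sum_pairs by (simp add: r_def sum.distrib)
  then show ?thesis by (simp add: mutual_energy_sum_commute[of lam q p])
qed

lemma theta_orthogonal: "x \<bullet> y = 0 \<Longrightarrow> theta x y = pi / 2"
  by (simp add: theta_def)

lemma theta_self: "norm x = 1 \<Longrightarrow> theta x x = 0"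
  by (simp add: theta_def dot_square_norm)

lemma theta_diagonal:
  assumes "\<bar>x \<bullet> y\<bar> = 1 / sqrt 2"
  shows "theta x y = pi / 4"
proof -
  have "\<bar>x \<bullet> y\<bar> = cos (pi / 4)" by (simp add: assms cos_45 real_div_sqrt)
  then show ?thesis unfolding theta_def by (simp add: arccos_cos)
qed

lemma twice_quarter_powr:
  fixes lam :: real
  assumes "lam < 1"
  shows "(pi / 2) powr lam < 2 * (pi / 4) powr lam"
proof -
  have "(2::real) powr lam < 2 powr 1" using assms by (subst powr_less_cancel_iff) auto
  then have "2 powr lam * (pi / 4) powr lam < 2 * (pi / 4) powr lam" by simp
  moreover have "2 powr lam * (pi / 4) powr lam = (pi / 2) powr lam"
    using powr_mult[of 2 "pi / 4" lam] by simp
  ultimately show ?thesis by simp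
qed

text \<open>The angles of a family are functions of its Gram matrix.\<close>

lemma mutual_energy_sum_orthonormal_eq:
  fixes e f :: "'k::finite \<Rightarrow> real ^ 'n::finite"
  assumes e: "\<And>i j. e i \<bullet> e j = (if i = j then 1 else 0)"
    and f: "\<And>i j. f i \<bullet> f j = (if i = j then 1 else 0)"
  shows "mutual_energy_sum lam e e = mutual_energy_sum lam f f"
  by (simp add: mutual_energy_sum_def theta_def e f)

text \<open>
  The value at \<open>b\<close> is the negative of the vector \<open>e b\<close> turned by \<open>\<pi>/4\<close>. Since \<open>theta\<close> depends only
  on the lines spanned by its arguments, the sign is immaterial.
\<close>

definition rotate_pair :: "'k \<Rightarrow> 'k \<Rightarrow> ('k \<Rightarrow> real ^ 'n) \<Rightarrow> 'k \<Rightarrow> real ^ 'n" where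
  "rotate_pair a b e =
     e(a := (1 / sqrt 2) *\<^sub>R (e a + e b), b := (1 / sqrt 2) *\<^sub>R (e a - e b))"

lemma orthonormal_rotate_pair:
  fixes e :: "'k \<Rightarrow> real ^ 'n::finite"
  assumes e: "\<And>i j. e i \<bullet> e j = (if i = j then 1 else 0)" and "a \<noteq> b"
  shows "rotate_pair a b e i \<bullet> rotate_pair a b e j = (if i = j then 1 else 0)"
  using \<open>a \<noteq> b\<close> by (auto simp: rotate_pair_def e algebra_simps)

lemma mutual_energy_sum_rotate_pair:
  fixes e :: "'k::finite \<Rightarrow> real ^ 'n::finite"
  assumes e: "\<And>i j. e i \<bullet> e j = (if i = j then 1 else 0)" and ab: "a \<noteq> b"
    and lam: "lam < 1"
  shows "mutual_energy_sum lam e e < mutual_energy_sum lam e (rotate_pair a b e)"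
proof -
  define f where "f = rotate_pair a b e"
  have f_other: "f j = e j" if "j \<noteq> a" "j \<noteq> b" for j
    using that by (simp add: f_def rotate_pair_def)
  have f_a: "f a = (1 / sqrt 2) *\<^sub>R (e a + e b)" and f_b: "f b = (1 / sqrt 2) *\<^sub>R (e a - e b)"
    using ab by (simp_all add: f_def rotate_pair_def)
  have norm_e: "norm (e i) = 1" for i by (simp add: norm_eq_sqrt_inner e)
  have split: "(\<Sum>j\<in>UNIV. g j) = g a + g b + (\<Sum>j\<in>-{a, b}. g j)" for g :: "'k \<Rightarrow> real"
    using sum.subset_diff[of "{a, b}" UNIV g] ab by (simp add: Compl_eq_Diff_UNIV)
  let ?row = "\<lambda>q i. \<Sum>j\<in>UNIV. theta (e i) (q j) powr lam"
  have strict: "?row e i < ?row f i" if i: "i \<in> {a, b}" for i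
  proof -
    have quarter: "theta (e i) (f j) = pi / 4" if "j \<in> {a, b}" for j
    proof (rule theta_diagonal)
      show "\<bar>e i \<bullet> f j\<bar> = 1 / sqrt 2"
        using i ab that by (auto simp: f_a f_b e inner_simps)
    qed
    have "theta (e i) (e a) powr lam + theta (e i) (e b) powr lam = (pi / 2) powr lam"
      using i ab by (auto simp: theta_self norm_e theta_orthogonal e)
    then show ?thesis
      using twice_quarter_powr[OF lam] by (simp add: split quarter f_other)
  qed
  \<comment> \<open>Every other \<open>e i\<close> is orthogonal to the whole plane of \<open>e a\<close> and \<open>e b\<close>, hence the rotation
    does not change its row.\<close>
  have same: "?row e i = ?row f i" if i: "i \<notin> {a, b}" for i
  proof -
    have "theta (e i) (f j) = theta (e i) (e j)" if "j \<in> {a, b}" for j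
      using i that by (auto simp: theta_def f_a f_b e inner_simps)
    then show ?thesis by (simp add: split f_other)
  qed
  have "(\<Sum>i\<in>UNIV. ?row e i) < (\<Sum>i\<in>UNIV. ?row f i)"
  proof (rule sum_strict_mono_ex1)
    show "\<forall>i\<in>UNIV. ?row e i \<le> ?row f i" using strict same by (metis order.refl less_imp_le)
    show "\<exists>i\<in>UNIV. ?row e i < ?row f i" using strict[of a] by blast
  qed simp
  then show ?thesis by (simp add: mutual_energy_sum_def f_def)
qed

theorem proposition8p3:
  fixes d :: nat and lam :: real and e :: "'n::finite \<Rightarrow> real ^ 'n"
  assumes "d \<ge> 1" and "CARD('n) = d + 1"
    and "0 < lam" and "lam < 1"
    and "orthonormal_basis e"
  shows "\<exists>\<mu> :: (real ^ 'n) measure.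
    borel_prob_on_sphere \<mu> \<and> energy lam \<mu> > energy lam (mu_ONB e)"
proof -
  have e: "e i \<bullet> e j = (if i = j then 1 else 0)" for i j
    using assms(5) by (simp add: orthonormal_basis_def)
  have "\<not> CARD('n) \<le> Suc 0" using assms(1,2) by simp
  then obtain a b :: 'n where ab: "a \<noteq> b" by (auto simp: card_le_Suc0_iff_eq)
  define f where "f = rotate_pair a b e"
  define r where "r = (\<lambda>(i, s). if s then e i else f i)"
  have f: "f i \<bullet> f j = (if i = j then 1 else 0)" for i j
    unfolding f_def by (rule orthonormal_rotate_pair[OF e ab])
  have norm_e: "norm (e i) = 1" and norm_f: "norm (f i) = 1" for i
    by (simp_all add: norm_eq_sqrt_inner e f)
  have norm_r: "norm (r k) = 1" for k
    by (simp add: r_def norm_e norm_f split: prod.split)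
  let ?E = "mutual_energy_sum lam"
  have "?E r r = 2 * ?E e e + 2 * ?E e f"
    unfolding r_def mutual_energy_sum_superposition
    using mutual_energy_sum_orthonormal_eq[OF f e] by simp
  moreover have "?E e e < ?E e f"
    unfolding f_def by (rule mutual_energy_sum_rotate_pair[OF e ab assms(4)])
  ultimately have "4 * ?E e e < ?E r r" by simp
  then have "4 * ?E e e / (real CARD('n \<times> bool))\<^sup>2 < ?E r r / (real CARD('n \<times> bool))\<^sup>2"
    by (rule divide_strict_right_mono) simp
  also have "\<dots> = energy lam (uniform_points r)"
    by (rule energy_uniform_points[OF norm_r, symmetric])
  also have "4 * ?E e e / (real CARD('n \<times> bool))\<^sup>2 = energy lam (mu_ONB e)"
    by (simp add: mu_ONB_eq_uniform_points norm_e energy_uniform_points power_mult_distrib)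
  finally have "energy lam (mu_ONB e) < energy lam (uniform_points r)" .
  then show ?thesis
    by (intro exI[of _ "uniform_points r"] conjI borel_prob_on_sphere_uniform_points[OF norm_r])
qed

end
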